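(* Let $f$ be a $C^1$ diffeomorphism of $M=\mathbb{R}^d/\mathbb{Z}^d$ with an ergodic invariant Borel probability measure $\mu$, and let $(f_m)_{m\ge1}$ be Anosov diffeomorphisms of $M$, with uniform hyperbolicity constants $c_m,\lambda_m$ and angle constants $a_m$. Let $A_1\subseteq A_2\subseteq\cdots$ be open sets with $A=\bigcup_mA_m$ $f$-invariant. Assume: (i) $f_m=f$ on $A_m$; (ii) there is $b>0$ with $|Df_m(y)|\le b$ and $|Df(y)|\le b$ for all $m$ and $y\in M$; (iii) $\lambda_m\le\lambda$ for all $m$, for some constant $\lambda<1$; (iv) $\mu(A)=1$. If $$\lim_{m\to\infty}\mu(M\setminus A_m)\log(a_mc_m)=0,$$ then $\mu$ is hyperbolic.
   Context: Tangent spaces identified with $\mathbb{R}^d$, $|\cdot|$ Euclidean/operator norm. A diffeomorphism $g$ is Anosov with constants $c>0$, $0<\lambda<1$, $a>0$ if for every $y\in M$ there is a splitting $T_yM=E^s(y)\oplus E^u(y)$ with $Dg(y)E^{s/u}(y)=E^{s/u}(g(y))$, $|Dg^k(y)\eta|\le c\lambda^k|\eta|$ for $\eta\in E^s(y)$, $|Dg^{-k}(y)\eta|\le c\lambda^k|\eta|$ for $\eta\in E^u(y)$, $k>0$, and $|\eta^s|\le a|\eta|$, $|\eta^u|\le a|\eta|$ whenever $\eta=\eta^s+\eta^u$ with $\eta^s\in E^s(y)$, $\eta^u\in E^u(y)$. $\mu$ is hyperbolic if for $\mu$-a.e. $x$ all Lyapunov exponents $\limsup_{k\to\infty}\frac1k\log|Df^k(x)v|$,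 $v\neq0$, are nonzero. *)

theory Defs
  imports "HOL-Probability.Probability"
begin

text \<open>The torus M = R^d / Z^d is represented by the fundamental domain [0,1)^d
  inside real^'n (d = CARD('n)); tangent spaces are identified with real^'n.
  A map of the torus is given through a lift F : R^d -> R^d.\<close>

definition int_vecs :: "(real^'n) set" where
  "int_vecs = {k. \<forall>i. k $ i \<in> \<int>}"

definition torus_proj :: "real^'n \<Rightarrow> real^'n" where
  "torus_proj x = (\<chi> i. frac (x $ i))"

definition Tor :: "(real^'n) set" where
  "Tor = {x. \<forall>i. 0 \<le> x $ i \<and> x $ i < 1}"

definition torus_open :: "(real^'n) set \<Rightarrow> bool" where
  "torus_open U \<longleftrightarrow> U \<subseteq> Tor \<and> open (torus_proj -` U)"

definition is_lift :: "(real^'n \<Rightarrow> real^'n) \<Rightarrow> bool" where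
  "is_lift F \<longleftrightarrow> (\<forall>x k. k \<in> int_vecs \<longrightarrow> F (x + k) - F x \<in> int_vecs)"

definition tmap :: "(real^'n \<Rightarrow> real^'n) \<Rightarrow> real^'n \<Rightarrow> real^'n" where
  "tmap F y = torus_proj (F y)"

definition C1_map :: "(real^'n \<Rightarrow> real^'n) \<Rightarrow> bool" where
  "C1_map F \<longleftrightarrow> (\<exists>F'. (\<forall>x. (F has_derivative blinfun_apply (F' x)) (at x))
                      \<and> continuous_on UNIV F')"

definition torus_diffeo :: "(real^'n \<Rightarrow> real^'n) \<Rightarrow> (real^'n \<Rightarrow> real^'n) \<Rightarrow> bool" where
  "torus_diffeo F G \<longleftrightarrow> is_lift F \<and> is_lift G \<and> C1_map F \<and> C1_map G \<and>
     (\<forall>x. torus_proj (F (G x)) = torus_proj x) \<and> (\<forall>x. torus_proj (G (F x)) = torus_proj x)"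

definition Dit :: "(real^'n \<Rightarrow> real^'n) \<Rightarrow> nat \<Rightarrow> real^'n \<Rightarrow> real^'n \<Rightarrow> real^'n" where
  "Dit F k y = frechet_derivative (F ^^ k) (at y)"

text \<open>Anosov with constants c, lam, a (G lifts the inverse, so D g^{-k} = Dit G k).\<close>
definition anosov :: "(real^'n \<Rightarrow> real^'n) \<Rightarrow> (real^'n \<Rightarrow> real^'n) \<Rightarrow> real \<Rightarrow> real \<Rightarrow> real \<Rightarrow> bool" where
  "anosov F G c lam a \<longleftrightarrow> c > 0 \<and> 0 < lam \<and> lam < 1 \<and> a > 0 \<and>
    (\<exists>Es Eu :: real^'n \<Rightarrow> (real^'n) set. \<forall>y\<in>Tor.
       subspace (Es y) \<and> subspace (Eu y) \<and>
       {u + v | u v. u \<in> Es y \<and> v \<in> Eu y} = UNIV \<and> Es y \<inter> Eu y = {0} \<and>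
       frechet_derivative F (at y) ` Es y = Es (tmap F y) \<and>
       frechet_derivative F (at y) ` Eu y = Eu (tmap F y) \<and>
       (\<forall>k>0. \<forall>\<eta>\<in>Es y. norm (Dit F k y \<eta>) \<le> c * lam ^ k * norm \<eta>) \<and>
       (\<forall>k>0. \<forall>\<eta>\<in>Eu y. norm (Dit G k y \<eta>) \<le> c * lam ^ k * norm \<eta>) \<and>
       (\<forall>\<eta>s\<in>Es y. \<forall>\<eta>u\<in>Eu y. norm \<eta>s \<le> a * norm (\<eta>s + \<eta>u) \<and> norm \<eta>u \<le> a * norm (\<eta>s + \<eta>u)))"

definition torus_prob :: "(real^'n) measure \<Rightarrow> bool" where
  "torus_prob \<mu> \<longleftrightarrow> prob_space \<mu> \<and> sets \<mu> = sets (restrict_space borel Tor)"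

definition invariant_measure :: "(real^'n \<Rightarrow> real^'n) \<Rightarrow> (real^'n) measure \<Rightarrow> bool" where
  "invariant_measure g \<mu> \<longleftrightarrow> g \<in> measurable \<mu> \<mu> \<and>
     (\<forall>B\<in>sets \<mu>. measure \<mu> (g -` B \<inter> space \<mu>) = measure \<mu> B)"

definition ergodic :: "(real^'n \<Rightarrow> real^'n) \<Rightarrow> (real^'n) measure \<Rightarrow> bool" where
  "ergodic g \<mu> \<longleftrightarrow> invariant_measure g \<mu> \<and>
     (\<forall>B\<in>sets \<mu>. g -` B \<inter> space \<mu> = B \<longrightarrow> measure \<mu> B = 0 \<or> measure \<mu> B = 1)"

definition hyperbolic_measure :: "(real^'n \<Rightarrow> real^'n) \<Rightarrow> (real^'n) measure \<Rightarrow> bool" where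
  "hyperbolic_measure F \<mu> \<longleftrightarrow> (AE x in \<mu>. \<forall>v. v \<noteq> 0 \<longrightarrow>
     limsup (\<lambda>k. ereal (ln (norm (Dit F k x v)) / real k)) \<noteq> 0)"

end

theory Submission
  imports Defs
begin

text \<open>For small \<open>\<epsilon> > 0\<close> let \<open>Z(x)\<close> be the subspace of vectors \<open>v\<close> with \<open>|Df\<^sup>k(x) v| = O(e\<^sup>\<epsilon>\<^sup>k)\<close>;
  it is mapped into \<open>Z(f x)\<close> by \<open>Df\<close> and contains every vector of zero exponent. By finite dimension the
  bound is uniform on the unit sphere of \<open>Z(x)\<close>, with one constant \<open>C\<close> for all \<open>x\<close> outside a set of
  small measure. If an orbit segment of length \<open>2N\<close> stays in \<open>A\<^sub>m\<close>, the splitting of \<open>f\<^sub>m\<close> gives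
  \<open>|Df\<^sup>N v| \<le> a\<^sub>m c\<^sub>m \<lambda>\<^sup>N (|v| + |Df\<^sup>2\<^sup>N v|)\<close>, so slow vectors are contracted exponentially over \<open>N\<close>
  steps as soon as \<open>N\<close> is a large multiple of \<open>log (a\<^sub>m c\<^sub>m)\<close>. The hypothesis allows such an \<open>N\<close> with
  \<open>N \<mu>(M \<setminus> A\<^sub>m)\<close> small, so this contraction takes place at all points outside a set of small
  measure. By the maximal ergodic theorem and ergodicity, typical orbits visit that exceptional set
  rarely, and there a vector grows by at most the factor \<open>b\<close> per step. Hence every vector in \<open>Z(x)\<close>
  has a negative exponent, and no exponent vanishes. This avoids Oseledets' theorem.\<close>
section \<open>The derivative cocycle on the torus\<close>

lemma torus_proj_eq_iff: "torus_proj x = torus_proj y \<longleftrightarrow> x - y \<in> int_vecs"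
proof -
  have "frac p = frac q \<longleftrightarrow> p - q \<in> \<int>" for p q :: real
  proof
    assume "frac p = frac q"
    then have "p - q = of_int (\<lfloor>p\<rfloor> - \<lfloor>q\<rfloor>)"
      by (simp add: frac_def)
    then show "p - q \<in> \<int>"
      by simp
  next
    assume "p - q \<in> \<int>"
    then obtain k where "p = q + of_int k"
      by (metis Ints_cases add.commute diff_add_cancel)
    then show "frac p = frac q"
      by (simp add: frac_def)
  qed
  then show ?thesis
    by (simp add: torus_proj_def int_vecs_def vec_eq_iff)
qed

lemma torus_proj_in_Tor: "torus_proj x \<in> Tor"
  by (simp add: torus_proj_def Tor_def frac_lt_1)

lemma torus_proj_Tor: "y \<in> Tor \<Longrightarrow> torus_proj y = y"
  by (simp add: torus_proj_def Tor_def vec_eq_iff frac_eq)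

lemma int_vecs_eq_0:
  assumes "k \<in> int_vecs" "norm k < 1"
  shows "k = 0"
proof -
  have "k $ i = 0" for i
  proof -
    obtain z where z: "k $ i = of_int z"
      using assms(1) by (auto simp: int_vecs_def elim: Ints_cases)
    have "\<bar>k $ i\<bar> < 1"
      using component_le_norm_cart[of k i] assms(2) by linarith
    then show ?thesis
      by (simp add: z)
  qed
  then show ?thesis
    by (simp add: vec_eq_iff)
qed

text \<open>On \<open>S\<close> the difference \<open>g - f\<close> takes values in a lattice, and
  it is continuous at \<open>x\<close>, hence constant near \<open>x\<close>. This transports
  derivatives between maps that agree only modulo integer vectors.\<close>

lemma has_derivative_cong_int_vecs:
  fixes f g :: "real^'n \<Rightarrow> real^'n"
  assumes "open S" "x \<in> S" and f: "(f has_derivative f') (at x)" and "isCont g x"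
    and int: "\<And>y. y \<in> S \<Longrightarrow> g y - f y \<in> int_vecs"
  shows "(g has_derivative f') (at x)"
proof -
  define h where "h y = g y - f y" for y
  have "isCont h x"
    unfolding h_def using assms(4) has_derivative_continuous[OF f] by (intro continuous_diff) auto
  then have "\<forall>\<^sub>F y in at x. dist (h y) (h x) < 1"
    unfolding isCont_def by (rule tendstoD) simp
  moreover have "\<forall>\<^sub>F y in at x. y \<in> S"
    using assms(1,2) by (rule eventually_at_in_open')
  ultimately have ev: "\<forall>\<^sub>F y in at x. f y + h x = g y"
  proof eventually_elim
    case (elim y)
    have "h y - h x \<in> int_vecs"
      using int[OF elim(2)] int[OF assms(2)] by (simp add: h_def int_vecs_def)
    then have "h y - h x = 0"
      using elim(1) by (intro int_vecs_eq_0) (simp_all add: dist_norm)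
    then show ?case
      by (simp add: h_def algebra_simps)
  qed
  have "((\<lambda>y. f y + h x) has_derivative f') (at x)"
    using f by (auto intro!: derivative_eq_intros)
  from this ev show ?thesis
    by (rule has_derivative_transform_eventually) (simp_all add: h_def)
qed

lemma torus_proj_lift_cong:
  assumes "is_lift F" "torus_proj x = torus_proj y"
  shows "torus_proj (F x) = torus_proj (F y)"
proof -
  have "x - y \<in> int_vecs"
    using assms(2) by (simp add: torus_proj_eq_iff)
  then have "F (y + (x - y)) - F y \<in> int_vecs"
    using assms(1) unfolding is_lift_def by blast
  then show ?thesis
    by (simp add: torus_proj_eq_iff)
qed

lemma is_lift_funpow:
  assumes "is_lift F"
  shows "is_lift (F ^^ k)"
proof (induction k)
  case 0
  then show ?case by (simp add: is_lift_def)
next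
  case (Suc k)
  show ?case
    unfolding is_lift_def
  proof (intro allI impI)
    fix x z :: "real^'a"
    assume "z \<in> int_vecs"
    then have "torus_proj ((F ^^ k) (x + z)) = torus_proj ((F ^^ k) x)"
      using Suc by (simp add: is_lift_def torus_proj_eq_iff)
    from torus_proj_lift_cong[OF assms this]
    show "(F ^^ Suc k) (x + z) - (F ^^ Suc k) x \<in> int_vecs"
      by (simp add: torus_proj_eq_iff)
  qed
qed

lemma torus_proj_funpow:
  assumes "is_lift F"
  shows "torus_proj ((F ^^ k) y) = (tmap F ^^ k) (torus_proj y)"
proof (induction k)
  case (Suc k)
  have "torus_proj ((F ^^ Suc k) y) = torus_proj (F ((tmap F ^^ k) (torus_proj y)))"
    using torus_proj_lift_cong[OF assms, of "(F ^^ k) y" "torus_proj ((F ^^ k) y)"]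
    by (simp add: Suc.IH[symmetric] torus_proj_Tor torus_proj_in_Tor)
  then show ?case
    by (simp add: tmap_def[of F "(tmap F ^^ k) (torus_proj y)"])
qed simp

lemma tmap_funpow_Tor: "y \<in> Tor \<Longrightarrow> (tmap F ^^ k) y \<in> Tor"
  by (cases k) (simp_all add: tmap_def torus_proj_in_Tor)

text \<open>A lift and its translate by an integer vector differ by integer vectors, so the
  derivative is periodic and may be computed at any representative of the torus point.\<close>

lemma has_derivative_lift_cong:
  assumes "is_lift F" "\<And>x. F differentiable (at x)" "torus_proj x = torus_proj y"
  shows "(F has_derivative frechet_derivative F (at y)) (at x)"
proof -
  define k where "k = x - y"
  have k: "k \<in> int_vecs"
    using assms(3) by (simp add: k_def torus_proj_eq_iff)
  have "(F has_derivative frechet_derivative F (at y)) (at (x - k))"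
    using assms(2) by (simp add: k_def frechet_derivative_works[symmetric])
  then have "((F \<circ> (\<lambda>z. z - k)) has_derivative frechet_derivative F (at y) \<circ> (\<lambda>z. z)) (at x)"
    by (intro diff_chain_at) (auto intro!: derivative_eq_intros)
  then have *: "((\<lambda>z. F (z - k)) has_derivative frechet_derivative F (at y)) (at x)"
    by (simp add: o_def)
  have "F z - F (z - k) \<in> int_vecs" for z
    using assms(1) k unfolding is_lift_def by (metis diff_add_cancel)
  then show ?thesis
    using differentiable_imp_continuous_within[OF assms(2)]
    by (intro has_derivative_cong_int_vecs[OF open_UNIV UNIV_I *]) auto
qed

section \<open>Iterates of lifts and their derivatives\<close>

lemma C1_map_differentiable: "C1_map F \<Longrightarrow> F differentiable (at x)"
  unfolding C1_map_def differentiable_def by blast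

lemma C1_map_continuous: "C1_map F \<Longrightarrow> continuous_on S F"
  by (meson C1_map_differentiable differentiable_imp_continuous_on differentiable_on_def
      differentiable_at_withinI)

lemma C1_map_comp:
  assumes "C1_map F" "C1_map G"
  shows "C1_map (F \<circ> G)"
proof -
  obtain F' G' where F: "\<And>x. (F has_derivative blinfun_apply (F' x)) (at x)" "continuous_on UNIV F'"
    and G: "\<And>x. (G has_derivative blinfun_apply (G' x)) (at x)" "continuous_on UNIV G'"
    using assms unfolding C1_map_def by blast
  have "(F \<circ> G has_derivative blinfun_apply (F' (G x) o\<^sub>L G' x)) (at x)" for x
    using diff_chain_at[OF G(1) F(1)] by (simp add: blinfun_compose.rep_eq o_def)
  moreover have "continuous_on UNIV (\<lambda>x. F' (G x) o\<^sub>L G' x)"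
    using G(2) C1_map_continuous[OF assms(2)] F(2)
    by (auto intro!: continuous_intros continuous_on_compose2[of UNIV F' UNIV G])
  ultimately show ?thesis
    unfolding C1_map_def by (intro exI[of _ "\<lambda>x. F' (G x) o\<^sub>L G' x"]) simp
qed

lemma C1_map_funpow:
  assumes "C1_map F"
  shows "C1_map (F ^^ k)"
proof (induction k)
  case 0
  have "\<forall>x::real^'a. ((\<lambda>y. y) has_derivative blinfun_apply id_blinfun) (at x)"
    by auto
  then show ?case
    unfolding C1_map_def by (auto simp: id_def intro!: exI[of _ "\<lambda>_. id_blinfun"] continuous_intros)
next
  case (Suc k)
  then show ?case
    using C1_map_comp[OF assms Suc] by (simp add: o_def)
qed

lemma C1_map_Dit:
  assumes "C1_map F"
  shows "(F ^^ k has_derivative Dit F k x) (at x)"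
  unfolding Dit_def
  using C1_map_differentiable[OF C1_map_funpow[OF assms]] frechet_derivative_works by blast

lemma bounded_linear_Dit: "C1_map F \<Longrightarrow> bounded_linear (Dit F k x)"
  using C1_map_Dit has_derivative_bounded_linear by blast

text \<open>Joint continuity in point and vector is what makes the conditions in the measurability
  proof for \<open>uniformly_slow\<close> closed.\<close>

lemma continuous_on_Dit:
  assumes "C1_map F"
  shows "continuous_on S (\<lambda>(x, v). Dit F k x v)"
proof -
  obtain D where D: "\<And>x. (F ^^ k has_derivative blinfun_apply (D x)) (at x)" "continuous_on UNIV D"
    using C1_map_funpow[OF assms, of k] unfolding C1_map_def by blast
  have "Dit F k x = blinfun_apply (D x)" for x
    unfolding Dit_def using D(1) by (metis frechet_derivative_at)
  then have "(\<lambda>(x, v). Dit F k x v) = (\<lambda>p. blinfun_apply (D (fst p)) (snd p))"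
    by (auto simp: fun_eq_iff)
  moreover have "continuous_on S (\<lambda>p. blinfun_apply (D (fst p)) (snd p))"
    using D(2) by (auto intro!: continuous_intros continuous_on_compose2[of UNIV D])
  ultimately show ?thesis
    by simp
qed

lemma Dit_0: "Dit F 0 x v = v"
  by (simp add: Dit_def id_def)

lemma Dit_1: "Dit F (Suc 0) x = frechet_derivative F (at x)"
  by (simp add: Dit_def)

lemma has_derivative_Dit_cong:
  assumes "is_lift F" "C1_map F" "torus_proj x = torus_proj y"
  shows "(F ^^ k has_derivative Dit F k y) (at x)"
  unfolding Dit_def
  using assms by (intro has_derivative_lift_cong is_lift_funpow C1_map_differentiable[OF C1_map_funpow])

text \<open>The chain rule gives the cocycle identity. The orbit of the lift may leave the
  fundamental domain, whereas the right-hand side is evaluated along the torus orbit; periodicity of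
  the derivative bridges the two.\<close>

lemma Dit_add:
  assumes "is_lift F" "C1_map F" "y \<in> Tor"
  shows "Dit F (j + k) y v = Dit F j ((tmap F ^^ k) y) (Dit F k y v)"
proof -
  let ?z = "(tmap F ^^ k) y"
  have "(F ^^ j has_derivative Dit F j ?z) (at ((F ^^ k) y))"
    using assms torus_proj_funpow[OF assms(1), of k y]
    by (intro has_derivative_Dit_cong) (simp_all add: torus_proj_Tor tmap_funpow_Tor)
  from diff_chain_at[OF C1_map_Dit[OF assms(2)] this]
  have "(F ^^ (j + k) has_derivative Dit F j ?z \<circ> Dit F k y) (at y)"
    by (simp add: funpow_add)
  then have "Dit F (j + k) y = Dit F j ?z \<circ> Dit F k y"
    unfolding Dit_def[of F "j + k"] by (metis frechet_derivative_at)
  then show ?thesis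
    by simp
qed

text \<open>The lift \<open>G\<close> inverts \<open>F\<close> only modulo integer vectors. The same
  holds for the iterates, and a continuous map that differs from the identity by integer vectors has
  the identity as derivative.\<close>

lemma Dit_inverse:
  assumes "torus_diffeo F G" "y \<in> Tor"
  shows "Dit G k ((tmap F ^^ k) y) (Dit F k y v) = v"
proof -
  have F: "is_lift F" "C1_map F" and G: "is_lift G" "C1_map G"
    and GF: "\<And>x. torus_proj (G (F x)) = torus_proj x"
    using assms(1) by (auto simp: torus_diffeo_def)
  let ?z = "(tmap F ^^ k) y"
  have proj: "torus_proj ((G ^^ k) ((F ^^ k) x)) = torus_proj x" for x
  proof (induction k)
    case (Suc k)
    have "torus_proj ((G ^^ Suc k) ((F ^^ Suc k) x)) = torus_proj ((G ^^ k) (G (F ((F ^^ k) x))))"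
      by (simp add: funpow_swap1)
    also have "\<dots> = torus_proj ((G ^^ k) ((F ^^ k) x))"
      by (rule torus_proj_lift_cong[OF is_lift_funpow[OF G(1)] GF])
    finally show ?case
      using Suc by simp
  qed simp
  have "(G ^^ k has_derivative Dit G k ?z) (at ((F ^^ k) y))"
    using G assms(2) torus_proj_funpow[OF F(1), of k y]
    by (intro has_derivative_Dit_cong) (simp_all add: torus_proj_Tor tmap_funpow_Tor)
  from diff_chain_at[OF C1_map_Dit[OF F(2)] this]
  have 1: "(G ^^ k \<circ> F ^^ k has_derivative Dit G k ?z \<circ> Dit F k y) (at y)" .
  have "(G ^^ k \<circ> F ^^ k has_derivative (\<lambda>v. v)) (at y)"
    using has_derivative_continuous[OF 1] proj
    by (intro has_derivative_cong_int_vecs[OF open_UNIV UNIV_I has_derivative_ident])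
       (auto simp: torus_proj_eq_iff)
  from has_derivative_unique[OF 1 this] show ?thesis
    by (simp add: fun_eq_iff)
qed

text \<open>Only the projected maps agree on \<open>A\<close>, so the lifts differ by integer
  vectors on the periodic preimage of \<open>A\<close>, which is open also near the faces of the
  fundamental domain. Derivatives then agree at each point of \<open>A\<close>, and the cocycle
  identity carries this along the orbit segment.\<close>

lemma Dit_agree:
  assumes F: "is_lift F" "C1_map F" and F': "is_lift F'" "C1_map F'"
    and A: "torus_open A" and agree: "\<And>y. y \<in> A \<Longrightarrow> tmap F' y = tmap F y"
    and y: "y \<in> Tor" and orb: "\<And>i. i < k \<Longrightarrow> (tmap F ^^ i) y \<in> A"
  shows "(tmap F' ^^ k) y = (tmap F ^^ k) y" "Dit F' k y v = Dit F k y v"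
proof -
  have deriv: "Dit F' (Suc 0) z = Dit F (Suc 0) z" if "z \<in> A" for z
  proof -
    have z: "torus_proj z = z"
      using that A by (auto simp: torus_open_def torus_proj_Tor)
    have "F' x - F x \<in> int_vecs" if "x \<in> torus_proj -` A" for x
    proof -
      have "torus_proj (F' x) = torus_proj (F' (torus_proj x))"
        "torus_proj (F x) = torus_proj (F (torus_proj x))"
        by (rule torus_proj_lift_cong, fact,
            simp add: torus_proj_Tor[OF torus_proj_in_Tor])+
      then show ?thesis
        using agree[of "torus_proj x"] that by (simp add: torus_proj_eq_iff[symmetric] tmap_def)
    qed
    moreover have "open (torus_proj -` A)" "z \<in> torus_proj -` A"
      using A z that by (auto simp: torus_open_def)
    moreover have "(F has_derivative Dit F (Suc 0) z) (at z)"
      using C1_map_Dit[OF F(2), of "Suc 0"] by simp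
    moreover have "isCont F' z"
      using differentiable_imp_continuous_within[OF C1_map_differentiable[OF F'(2)]] .
    ultimately have "(F' has_derivative Dit F (Suc 0) z) (at z)"
      by (meson has_derivative_cong_int_vecs)
    then show ?thesis
      unfolding Dit_1[of F'] by (metis frechet_derivative_at)
  qed
  have "(tmap F' ^^ k) y = (tmap F ^^ k) y \<and> Dit F' k y v = Dit F k y v"
    using orb
  proof (induction k)
    case (Suc k)
    then have "(tmap F ^^ k) y \<in> A" and IH: "(tmap F' ^^ k) y = (tmap F ^^ k) y"
      "Dit F' k y v = Dit F k y v"
      by auto
    then show ?case
      using Dit_add[OF F y, of "Suc 0" k v] Dit_add[OF F' y, of "Suc 0" k v]
      by (simp add: agree deriv)
  qed (simp add: Dit_0)
  then show "(tmap F' ^^ k) y = (tmap F ^^ k) y" "Dit F' k y v = Dit F k y v"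
    by auto
qed

section \<open>A maximal ergodic theorem\<close>

lemma measurable_funpow:
  assumes "T \<in> measurable M M"
  shows "(T ^^ i) \<in> measurable M M"
proof (induction i)
  case (Suc i)
  then show ?case
    using assms by (simp add: measurable_comp)
qed simp

lemma maximal_ergodic:
  fixes \<phi> :: "'a \<Rightarrow> real" and T :: "'a \<Rightarrow> 'a"
  assumes T: "T \<in> measurable M M" and inv: "distr M M T = M" and \<phi>: "integrable M \<phi>"
  shows "0 \<le> (\<integral>x. indicator {x \<in> space M. \<exists>k\<le>n. 0 < (\<Sum>i<k. \<phi> ((T ^^ i) x))} x * \<phi> x \<partial>M)"
proof (cases n)
  case 0
  then have empty: "{x \<in> space M. \<exists>k\<le>n. 0 < (\<Sum>i<k. \<phi> ((T ^^ i) x))} = {}"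
    by simp
  show ?thesis
    by (simp only: empty) simp
next
  case (Suc m)
  \<comment> \<open>\<open>g n\<close> is the maximum of the Birkhoff sums of \<open>\<phi>\<close> of length at most \<open>n\<close> (Garsia's proof).\<close>
  define g where "g = rec_nat (\<lambda>_. 0) (\<lambda>_ h x. max 0 (\<phi> x + h (T x)))"
  have g_0: "g 0 x = 0" and g_Suc: "g (Suc n) x = max 0 (\<phi> x + g n (T x))" for n x
    by (simp_all add: g_def)
  have g_nonneg: "0 \<le> g n x" for n x
    by (cases n) (simp_all add: g_0 g_Suc)
  have g_mono: "g n x \<le> g (Suc n) x" for n x
  proof (induction n arbitrary: x)
    case (Suc n)
    from Suc[of "T x"] show ?case
      unfolding g_Suc[of n] g_Suc[of "Suc n"] by (auto simp: max_def)
  qed (simp add: g_0 g_nonneg)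
  have g_int: "integrable M (g n)" and g_int_T: "integrable M (\<lambda>x. g n (T x))"
    and g_T: "(\<integral>x. g n (T x) \<partial>M) = (\<integral>x. g n x \<partial>M)" for n
  proof -
    have T_int: "integrable M (\<lambda>x. h (T x))" if "integrable M h" for h :: "'a \<Rightarrow> real"
      using integrable_distr[OF T] that inv by simp
    show int: "integrable M (g n)"
    proof (induction n)
      case (Suc n)
      show ?case
        unfolding g_Suc[abs_def] using \<phi> T_int[OF Suc] by auto
    qed (simp add: g_0[abs_def])
    then show "integrable M (\<lambda>x. g n (T x))"
      by (rule T_int)
    show "(\<integral>x. g n (T x) \<partial>M) = (\<integral>x. g n x \<partial>M)"
      using integral_distr[OF T, of "g n"] int inv by auto
  qed
  have sum_shift: "(\<Sum>i<Suc k. \<phi> ((T ^^ i) x)) = \<phi> x + (\<Sum>i<k. \<phi> ((T ^^ i) (T x)))" for k x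
    by (subst sum.lessThan_Suc_shift) (simp add: funpow_swap1)
  have sum_le: "(\<Sum>i<k. \<phi> ((T ^^ i) x)) \<le> g n x" if "k \<le> n" for k n x
    using that
  proof (induction n arbitrary: k x)
    case (Suc n)
    show ?case
    proof (cases k)
      case (Suc l)
      then have "(\<Sum>i<l. \<phi> ((T ^^ i) (T x))) \<le> g n (T x)"
        using Suc.IH[of l "T x"] Suc.prems by simp
      then show ?thesis
        unfolding Suc sum_shift g_Suc by simp
    qed (simp add: g_nonneg)
  qed (simp add: g_0)
  have ex_sum: "\<exists>k\<le>n. g n x = (\<Sum>i<k. \<phi> ((T ^^ i) x))" for n x
  proof (induction n arbitrary: x)
    case (Suc n)
    obtain k where k: "k \<le> n" "g n (T x) = (\<Sum>i<k. \<phi> ((T ^^ i) (T x)))"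
      using Suc by blast
    show ?case
    proof (cases "\<phi> x + g n (T x) \<le> 0")
      case True
      then show ?thesis
        by (intro exI[of _ 0]) (simp add: g_Suc)
    next
      case False
      then have "g (Suc n) x = (\<Sum>i<Suc k. \<phi> ((T ^^ i) x))"
        unfolding sum_shift k(2)[symmetric] by (simp add: g_Suc)
      then show ?thesis
        using k(1) by blast
    qed
  qed (simp add: g_0)
  define P where "P = {x \<in> space M. 0 < g n x}"
  have P_eq: "{x \<in> space M. \<exists>k\<le>n. 0 < (\<Sum>i<k. \<phi> ((T ^^ i) x))} = P"
  proof -
    have "(\<exists>k\<le>n. 0 < (\<Sum>i<k. \<phi> ((T ^^ i) x))) \<longleftrightarrow> 0 < g n x" for x
      using sum_le[of _ n x] ex_sum[of n x] by (metis less_le_trans)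
    then show ?thesis
      by (simp add: P_def)
  qed
  have g_meas: "g n \<in> borel_measurable M"
    using g_int by auto
  then have P_sets: "P \<in> sets M"
    unfolding P_def by measurable
  \<comment> \<open>Invariance makes this integral vanish. On \<open>P\<close> the second argument
    of the maximum defining \<open>g n\<close> is attained, and \<open>g m \<le> g n\<close> yields
    \<open>g n x - g n (T x) \<le> \<phi> x\<close>; off \<open>P\<close> the left side is
    nonpositive.\<close>
  have "0 = (\<integral>x. g n x - g n (T x) \<partial>M)"
    using g_int g_int_T g_T by simp
  also have "\<dots> \<le> (\<integral>x. indicator P x * \<phi> x \<partial>M)"
  proof (rule integral_mono)
    show "integrable M (\<lambda>x. g n x - g n (T x))"
      using g_int g_int_T by simp
    show "integrable M (\<lambda>x. indicator P x * \<phi> x)"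
      using integrable_mult_indicator[OF P_sets \<phi>] by simp
    fix x assume x: "x \<in> space M"
    show "g n x - g n (T x) \<le> indicator P x * \<phi> x"
    proof (cases "x \<in> P")
      case True
      then have "g n x = \<phi> x + g m (T x)"
        unfolding P_def Suc g_Suc by (auto simp: max_def split: if_splits)
      then show ?thesis
        using True g_mono[of m "T x"] by (simp add: Suc)
    next
      case False
      then show ?thesis
        using x g_nonneg[of n "T x"] by (simp add: P_def)
    qed
  qed
  finally show ?thesis
    unfolding P_eq .
qed

text \<open>Apply the maximal ergodic theorem to \<open>indicator E - t\<close>, whose Birkhoff sums
  are positive exactly when visits to \<open>E\<close> exceed frequency \<open>t\<close>. Continuity
  of the measure along the increasing sets \<open>P n\<close> removes the finite horizon.\<close>

lemma maximal_visit_inequality: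
  fixes T :: "'a \<Rightarrow> 'a"
  assumes "prob_space M" and T: "T \<in> measurable M M" and inv: "distr M M T = M"
    and E: "E \<in> sets M"
  shows "t * measure M {x \<in> space M. \<exists>k. t * real k < (\<Sum>i<k. indicator E ((T ^^ i) x))} \<le> measure M E"
proof -
  interpret prob_space M by fact
  define P where "P n = {x \<in> space M. \<exists>k\<le>n. 0 < (\<Sum>i<k. indicator E ((T ^^ i) x) - t)}" for n :: nat
  note [measurable] = E measurable_funpow[OF T]
  have P_sets [measurable]: "P n \<in> sets M" for n
    unfolding P_def by measurable
  have indicator_int: "integrable M (indicator B :: 'a \<Rightarrow> real)" if "B \<in> sets M" for B
    using that by (intro integrable_real_indicator) (auto simp: less_top[symmetric])
  have bound: "t * measure M (P n) \<le> measure M E" for n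
  proof -
    have "0 \<le> (\<integral>x. indicator (P n) x * (indicator E x - t) \<partial>M)"
      unfolding P_def using T inv
      by (intro maximal_ergodic Bochner_Integration.integrable_diff indicator_int E) auto
    also have "\<dots> = (\<integral>x. indicator (P n \<inter> E) x - t * indicator (P n) x \<partial>M)"
      by (intro Bochner_Integration.integral_cong) (auto simp: indicator_def)
    also have "\<dots> = measure M (P n \<inter> E) - t * measure M (P n)"
      by (subst Bochner_Integration.integral_diff)
         (auto intro!: indicator_int integrable_mult_right)
    also have "measure M (P n \<inter> E) \<le> measure M E"
      by (intro finite_measure_mono) auto
    finally show ?thesis by simp
  qed
  have "(\<lambda>n. t * measure M (P n)) \<longlonglongrightarrow> t * measure M (\<Union>n. P n)"
    by (intro tendsto_mult_left finite_Lim_measure_incseq)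
       (auto simp: incseq_def P_def intro: order_trans)
  then have "t * measure M (\<Union>n. P n) \<le> measure M E"
    using bound by (intro LIMSEQ_le_const2) auto
  also have "(\<Union>n. P n) = {x \<in> space M. \<exists>k. t * real k < (\<Sum>i<k. indicator E ((T ^^ i) x))}"
    by (auto simp: P_def sum_subtractf algebra_simps)
  finally show ?thesis .
qed

text \<open>A substitute for Birkhoff's theorem: ergodicity gives \<open>Q\<close> measure 0 or 1,
  and the maximal inequality bounds that measure by \<open>measure M E / t\<close>, which is below
  1.\<close>

lemma ergodic_visits_bound:
  fixes T :: "real^'n \<Rightarrow> real^'n"
  assumes prob: "prob_space M" and erg: "ergodic T M" and E: "E \<in> sets M" and less: "measure M E < t"
  shows "AE x in M. \<exists>K. \<forall>n. (\<Sum>i<n. indicator E ((T ^^ i) x)) \<le> K + t * real n"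
proof -
  interpret prob_space M by fact
  define S :: "nat \<Rightarrow> real^'n \<Rightarrow> real" where "S n x = (\<Sum>i<n. indicator E ((T ^^ i) x))" for n x
  \<comment> \<open>Since \<open>S n (T x)\<close> and \<open>S (Suc n) x\<close> differ by at most 1, unboundedness of \<open>S n x - t n\<close>
    is a \<open>T\<close>-invariant condition.\<close>
  define Q where "Q = {x \<in> space M. \<forall>K::nat. \<exists>n. real K + t * real n < S n x}"
  have t: "0 < t"
    using less measure_nonneg[of M E] by linarith
  have T [measurable]: "T \<in> measurable M M"
    and pres: "\<And>B. B \<in> sets M \<Longrightarrow> measure M (T -` B \<inter> space M) = measure M B"
    using erg by (auto simp: ergodic_def invariant_measure_def)
  have distr: "distr M M T = M"
    by (rule measure_eqI) (simp_all add: emeasure_distr[OF T] emeasure_eq_measure pres)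
  note [measurable] = E measurable_funpow[OF T]
  have Q_sets: "Q \<in> sets M"
    unfolding Q_def S_def by measurable
  have S_Suc: "S (Suc n) x = indicator E x + S n (T x)" for n x
    unfolding S_def by (subst sum.lessThan_Suc_shift) (simp add: funpow_swap1)
  have "T x \<in> Q \<longleftrightarrow> x \<in> Q" if x: "x \<in> space M" for x
  proof
    assume Tx: "T x \<in> Q"
    have "\<exists>n. real K + t * real n < S n x" for K
    proof -
      \<comment> \<open>Passing from \<open>T x\<close> to \<open>x\<close> lengthens the sum by one
        term and raises the threshold by \<open>t\<close>; the surplus
        \<open>nat \<lceil>t\<rceil>\<close> pays for this.\<close>
      obtain n where "real (K + nat \<lceil>t\<rceil>) + t * real n < S n (T x)"
        using Tx unfolding Q_def by blast
      moreover have "t \<le> real (nat \<lceil>t\<rceil>)"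
        by (rule real_nat_ceiling_ge)
      ultimately have "real K + t * real (Suc n) < S (Suc n) x"
        unfolding S_Suc by (cases "x \<in> E") (simp_all add: algebra_simps)
      then show ?thesis ..
    qed
    then show "x \<in> Q"
      using x by (simp add: Q_def)
  next
    assume x': "x \<in> Q"
    have "\<exists>n. real K + t * real n < S n (T x)" for K
    proof -
      \<comment> \<open>The extra unit in \<open>Suc K\<close> pays for the term of time 0, which is
        dropped in passing to \<open>T x\<close>.\<close>
      obtain n where n: "real (Suc K) + t * real n < S n x"
        using x' unfolding Q_def by blast
      then obtain m where m: "n = Suc m"
        by (cases n) (auto simp: S_def)
      have "real K + t * real m < S m (T x)"
        using n t unfolding m S_Suc by (cases "x \<in> E") (simp_all add: algebra_simps)
      then show ?thesis ..
    qed
    then show "T x \<in> Q"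
      using measurable_space[OF T x] by (simp add: Q_def)
  qed
  then have "T -` Q \<inter> space M = Q"
    unfolding Q_def by auto
  then have "measure M Q = 0 \<or> measure M Q = 1"
    using erg Q_sets unfolding ergodic_def by blast
  moreover have "measure M Q \<noteq> 1"
  proof
    assume "measure M Q = 1"
    moreover have "measure M Q \<le> measure M {x \<in> space M. \<exists>k. t * real k < (\<Sum>i<k. indicator E ((T ^^ i) x))}"
    proof (rule finite_measure_mono)
      show "Q \<subseteq> {x \<in> space M. \<exists>k. t * real k < (\<Sum>i<k. indicator E ((T ^^ i) x))}"
      proof
        fix x assume "x \<in> Q"
        then have "x \<in> space M" "\<exists>n. real 0 + t * real n < S n x"
          unfolding Q_def by blast+
        then show "x \<in> {x \<in> space M. \<exists>k. t * real k < (\<Sum>i<k. indicator E ((T ^^ i) x))}"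
          by (simp add: S_def)
      qed
    qed measurable
    ultimately have "t * 1 \<le> t * measure M {x \<in> space M. \<exists>k. t * real k < (\<Sum>i<k. indicator E ((T ^^ i) x))}"
      using t by (intro mult_left_mono) auto
    with maximal_visit_inequality[OF prob T distr E, of t] less show False
      by linarith
  qed
  ultimately have "Q \<in> null_sets M"
    using Q_sets by (auto simp: null_sets_def emeasure_eq_measure)
  then have "AE x in M. x \<notin> Q"
    by (rule AE_not_in)
  with AE_space show ?thesis
  proof eventually_elim
    case (elim x)
    then obtain K :: nat where "\<And>n. S n x \<le> real K + t * real n"
      unfolding Q_def by (auto simp: not_less)
    then show ?case
      unfolding S_def by blast
  qed
qed

section \<open>Slowly growing vectors\<close>

text \<open>Walk greedily: jump by \<open>N\<close> from a time that is not bad, advance by one step otherwise.\<close>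

lemma greedy_decay:
  fixes u :: "nat \<Rightarrow> real" and \<kappa> \<beta> :: real
  assumes N: "0 < N" and nonneg: "0 \<le> \<kappa>" "0 \<le> \<beta>"
    and step: "\<And>k. u (Suc k) \<le> u k + \<beta>"
    and jump: "\<And>k. \<not> bad k \<Longrightarrow> u (k + N) \<le> u k - \<kappa> * real N"
  shows "u (k + n) \<le> u k - \<kappa> * real n + (\<beta> + \<kappa>) * (\<Sum>i=k..<k+n. of_bool (bad i)) + (\<beta> + \<kappa>) * real N"
proof (induction n arbitrary: k rule: less_induct)
  case (less n)
  have sum_nonneg: "0 \<le> (\<beta> + \<kappa>) * (\<Sum>i=p..<q. of_bool (bad i))" for p q
    using nonneg by (intro mult_nonneg_nonneg sum_nonneg) auto
  consider "n < N" | "N \<le> n" "bad k" | "N \<le> n" "\<not> bad k"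
    by linarith
  then show ?case
  proof cases
    case 1
    \<comment> \<open>The walk ends with an incomplete block, which may grow by
      \<open>\<beta>\<close> per step and misses the decay \<open>\<kappa>\<close>. The last term
      covers this, and the recursion pays it only once.\<close>
    have "u (k + n) \<le> u k + \<beta> * real n"
    proof (induction n)
      case (Suc n)
      then show ?case
        using step[of "k + n"] by (simp add: algebra_simps)
    qed simp
    moreover have "(\<beta> + \<kappa>) * real n \<le> (\<beta> + \<kappa>) * real N"
      using 1 nonneg by (intro mult_left_mono) auto
    ultimately show ?thesis
      using sum_nonneg[of k "k + n"] by (simp add: algebra_simps)
  next
    case 2
    then obtain m where m: "n = Suc m"
      using N by (cases n) auto
    \<comment> \<open>A bad time costs the growth \<open>\<beta>\<close> and the decay
      \<open>\<kappa>\<close> that it fails to bring, hence the weight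
      \<open>\<beta> + \<kappa>\<close>.\<close>
    have "(\<Sum>i=k..<k+n. of_bool (bad i)) = 1 + (\<Sum>i=Suc k..<Suc k+m. of_bool (bad i) :: real)"
      using 2(2) sum.atLeast_Suc_lessThan[of k "k + n" "\<lambda>i. of_bool (bad i) :: real"] by (simp add: m)
    with less[of m "Suc k"] step[of k] show ?thesis
      by (simp add: m algebra_simps)
  next
    case 3
    have "(\<Sum>i=k+N..<k+n. of_bool (bad i) :: real) \<le> (\<Sum>i=k..<k+n. of_bool (bad i))"
      by (rule sum_mono2) auto
    then have "(\<beta> + \<kappa>) * (\<Sum>i=k+N..<k+n. of_bool (bad i)) \<le> (\<beta> + \<kappa>) * (\<Sum>i=k..<k+n. of_bool (bad i))"
      using nonneg by (intro mult_left_mono) auto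
    with less[of "n - N" "k + N"] jump[OF 3(2)] N 3(1) show ?thesis
      by (simp add: of_nat_diff algebra_simps)
  qed
qed

text \<open>The bound is imposed at all times, with a constant depending on the vector, in place of
  a condition on the limsup: for a C1 map and fixed \<open>D\<close> it is closed in point and
  vector, on which measurability below relies.\<close>

definition slow_space :: "(real^'n \<Rightarrow> real^'n) \<Rightarrow> real \<Rightarrow> real^'n \<Rightarrow> (real^'n) set" where
  "slow_space F \<epsilon> x = {v. \<exists>D. \<forall>k. norm (Dit F k x v) \<le> D * exp (\<epsilon> * real k)}"

definition uniformly_slow :: "(real^'n \<Rightarrow> real^'n) \<Rightarrow> real \<Rightarrow> real \<Rightarrow> (real^'n) set" where
  "uniformly_slow F \<epsilon> C =
    {x. \<forall>v\<in>slow_space F \<epsilon> x. \<forall>k. norm (Dit F k x v) \<le> C * exp (\<epsilon> * real k) * norm v}"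

lemma uniformly_slow_mono: "C \<le> C' \<Longrightarrow> uniformly_slow F \<epsilon> C \<subseteq> uniformly_slow F \<epsilon> C'"
  unfolding uniformly_slow_def
proof safe
  fix x v k
  assume "C \<le> C'" "\<forall>v\<in>slow_space F \<epsilon> x. \<forall>k. norm (Dit F k x v) \<le> C * exp (\<epsilon> * real k) * norm v"
    and "v \<in> slow_space F \<epsilon> x"
  then have "norm (Dit F k x v) \<le> C * exp (\<epsilon> * real k) * norm v"
    by blast
  also have "\<dots> \<le> C' * exp (\<epsilon> * real k) * norm v"
    using \<open>C \<le> C'\<close> by (intro mult_right_mono) auto
  finally show "norm (Dit F k x v) \<le> C' * exp (\<epsilon> * real k) * norm v" .
qed

lemma subspace_slow_space:
  assumes "C1_map F"
  shows "subspace (slow_space F \<epsilon> x)"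
  unfolding subspace_def
proof (intro conjI ballI allI)
  note lin = bounded_linear.linear[OF bounded_linear_Dit[OF assms]]
  show "0 \<in> slow_space F \<epsilon> x"
    unfolding slow_space_def using linear_0[OF lin] by (auto intro: exI[of _ 0])
  show "v + w \<in> slow_space F \<epsilon> x" if vw: "v \<in> slow_space F \<epsilon> x" "w \<in> slow_space F \<epsilon> x" for v w
  proof -
    obtain D E where "\<And>k. norm (Dit F k x v) \<le> D * exp (\<epsilon> * real k)"
      "\<And>k. norm (Dit F k x w) \<le> E * exp (\<epsilon> * real k)"
      using vw unfolding slow_space_def by blast
    then have "norm (Dit F k x (v + w)) \<le> (D + E) * exp (\<epsilon> * real k)" for k
      unfolding linear_add[OF lin] distrib_right by (intro norm_triangle_mono)
    then show ?thesis
      unfolding slow_space_def by blast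
  qed
  show "r *\<^sub>R v \<in> slow_space F \<epsilon> x" if v: "v \<in> slow_space F \<epsilon> x" for r v
  proof -
    obtain D where "\<And>k. norm (Dit F k x v) \<le> D * exp (\<epsilon> * real k)"
      using v unfolding slow_space_def by blast
    then have "norm (Dit F k x (r *\<^sub>R v)) \<le> (\<bar>r\<bar> * D) * exp (\<epsilon> * real k)" for k
      unfolding linear_scale[OF lin] norm_scaleR mult.assoc by (intro mult_left_mono) auto
    then show ?thesis
      unfolding slow_space_def by blast
  qed
qed

text \<open>Take an orthonormal basis of the slow space: its finitely many constants add up, and the
  coefficients of a vector are at most its norm.\<close>

lemma ex_uniformly_slow:
  assumes "C1_map F"
  shows "\<exists>C. x \<in> uniformly_slow F \<epsilon> C"
proof -
  note lin = bounded_linear.linear[OF bounded_linear_Dit[OF assms]]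
  obtain B where B: "B \<subseteq> slow_space F \<epsilon> x" "pairwise orthogonal B" "\<And>w. w \<in> B \<Longrightarrow> norm w = 1"
    "independent B" "span B = slow_space F \<epsilon> x"
    using orthonormal_basis_subspace[OF subspace_slow_space[OF assms]] by metis
  then have fin: "finite B"
    using independent_imp_finite by blast
  have "\<forall>w\<in>B. \<exists>D. \<forall>k. norm (Dit F k x w) \<le> D * exp (\<epsilon> * real k)"
    using B(1) unfolding slow_space_def by blast
  then obtain D where D: "\<And>w k. w \<in> B \<Longrightarrow> norm (Dit F k x w) \<le> D w * exp (\<epsilon> * real k)"
    by metis
  have "norm (Dit F k x v) \<le> (\<Sum>w\<in>B. D w) * exp (\<epsilon> * real k) * norm v"
    if "v \<in> slow_space F \<epsilon> x" for v k
  proof -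
    have "(\<Sum>w\<in>B. (v \<bullet> w) *\<^sub>R w) = v"
      using orthonormal_basis_expand[OF B(2,3) _ fin] that B(5) by simp
    moreover have "Dit F k x (\<Sum>w\<in>B. (v \<bullet> w) *\<^sub>R w) = (\<Sum>w\<in>B. (v \<bullet> w) *\<^sub>R Dit F k x w)"
      by (simp add: linear_sum[OF lin] linear_scale[OF lin])
    ultimately have "Dit F k x v = (\<Sum>w\<in>B. (v \<bullet> w) *\<^sub>R Dit F k x w)"
      by simp
    also have "norm \<dots> \<le> (\<Sum>w\<in>B. norm v * (D w * exp (\<epsilon> * real k)))"
    proof (rule sum_norm_le)
      fix w assume w: "w \<in> B"
      have "\<bar>v \<bullet> w\<bar> \<le> norm v"
        using Cauchy_Schwarz_ineq2[of v w] B(3)[OF w] by simp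
      then show "norm ((v \<bullet> w) *\<^sub>R Dit F k x w) \<le> norm v * (D w * exp (\<epsilon> * real k))"
        using D[OF w, of k] by (simp add: mult_mono)
    qed
    also have "\<dots> = (\<Sum>w\<in>B. D w) * exp (\<epsilon> * real k) * norm v"
      by (simp add: sum_distrib_left sum_distrib_right mult_ac)
    finally show ?thesis .
  qed
  then show ?thesis
    unfolding uniformly_slow_def by blast
qed

text \<open>\<open>slow_space F \<epsilon> x\<close> is an increasing union over \<open>D\<close> of closed cones that depend on \<open>x\<close> through
  closed conditions, so the complement is a countable union of projections of closed sets along the
  unit sphere.\<close>

lemma uniformly_slow_borel:
  assumes "C1_map F"
  shows "uniformly_slow F \<epsilon> C \<in> sets borel"
proof -
  note lin = bounded_linear.linear[OF bounded_linear_Dit[OF assms]]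
  \<comment> \<open>Violating the bound is a strict inequality; the margin
    \<open>inverse (real (Suc q))\<close> makes it closed. Natural \<open>D\<close> and
    \<open>q\<close> leave a countable union, and compactness of the unit sphere keeps the
    projections closed.\<close>
  define Z where "Z D j q =
    {p. (\<forall>k. norm (Dit F k (snd p) (fst p)) \<le> real D * exp (\<epsilon> * real k)) \<and>
      (C + inverse (real (Suc q))) * exp (\<epsilon> * real j) \<le> norm (Dit F j (snd p) (fst p))}"
    for D j q :: nat
  have cont: "continuous_on UNIV (\<lambda>p. norm (Dit F k (snd p) (fst p)))" for k
  proof -
    have "continuous_on UNIV (\<lambda>p. (\<lambda>(x, v). Dit F k x v) (snd p, fst p))"
      by (rule continuous_on_compose2[OF continuous_on_Dit[OF assms, of UNIV]])
         (auto intro!: continuous_intros)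
    then show ?thesis
      by (auto intro!: continuous_intros)
  qed
  have "closed (Z D j q)" for D j q
    unfolding Z_def
    by (intro closed_Collect_conj closed_Collect_all closed_Collect_le cont continuous_on_const)
  then have closed: "closed {x. \<exists>v. v \<in> sphere 0 1 \<and> (v, x) \<in> Z D j q}" for D j q
    by (intro closed_compact_projection) auto
  have "- uniformly_slow F \<epsilon> C = (\<Union>D j q. {x. \<exists>v. v \<in> sphere 0 1 \<and> (v, x) \<in> Z D j q})"
  proof (intro equalityI subsetI)
    fix x assume "x \<in> - uniformly_slow F \<epsilon> C"
    then obtain v j where v: "v \<in> slow_space F \<epsilon> x"
      and j: "C * exp (\<epsilon> * real j) * norm v < norm (Dit F j x v)"
      unfolding uniformly_slow_def by (auto simp: not_le)
    have "v \<noteq> 0"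
      using j linear_0[OF lin] by auto
    define w where "w = inverse (norm v) *\<^sub>R v"
    have w: "norm w = 1" "w \<in> slow_space F \<epsilon> x"
      using \<open>v \<noteq> 0\<close> v subspace_slow_space[OF assms] by (auto simp: w_def subspace_scale)
    have "norm (Dit F j x w) = norm (Dit F j x v) / norm v"
      unfolding w_def linear_scale[OF lin] by (simp add: divide_inverse)
    then have "C * exp (\<epsilon> * real j) < norm (Dit F j x w)"
      using j \<open>v \<noteq> 0\<close> by (simp add: pos_less_divide_eq)
    then have "C < norm (Dit F j x w) / exp (\<epsilon> * real j)"
      by (simp add: pos_less_divide_eq)
    then obtain q where "inverse (real (Suc q)) < norm (Dit F j x w) / exp (\<epsilon> * real j) - C"
      using reals_Archimedean by (metis diff_gt_0_iff_gt)
    then have q: "(C + inverse (real (Suc q))) * exp (\<epsilon> * real j) \<le> norm (Dit F j x w)"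
      by (simp add: field_simps del: of_nat_Suc)
    obtain D where D: "\<And>k. norm (Dit F k x w) \<le> D * exp (\<epsilon> * real k)"
      using w(2) unfolding slow_space_def by blast
    have "norm (Dit F k x w) \<le> real (nat \<lceil>D\<rceil>) * exp (\<epsilon> * real k)" for k
      using D[of k] real_nat_ceiling_ge[of D] by (meson exp_ge_zero mult_right_mono order_trans)
    then have "(w, x) \<in> Z (nat \<lceil>D\<rceil>) j q"
      using q by (simp add: Z_def)
    then show "x \<in> (\<Union>D j q. {x. \<exists>v. v \<in> sphere 0 1 \<and> (v, x) \<in> Z D j q})"
      using w(1) by auto
  next
    fix x assume "x \<in> (\<Union>D j q. {x. \<exists>v. v \<in> sphere 0 1 \<and> (v, x) \<in> Z D j q})"
    then obtain D j q v where v: "norm v = 1"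
      "\<forall>k. norm (Dit F k x v) \<le> real D * exp (\<epsilon> * real k)"
      and j: "(C + inverse (real (Suc q))) * exp (\<epsilon> * real j) \<le> norm (Dit F j x v)"
      by (auto simp: Z_def)
    have "C * exp (\<epsilon> * real j) < (C + inverse (real (Suc q))) * exp (\<epsilon> * real j)"
      by simp
    also note j
    finally have "\<not> norm (Dit F j x v) \<le> C * exp (\<epsilon> * real j) * norm v"
      using v(1) by simp
    moreover have "v \<in> slow_space F \<epsilon> x"
      using v(2) unfolding slow_space_def by blast
    ultimately show "x \<in> - uniformly_slow F \<epsilon> C"
      unfolding uniformly_slow_def by blast
  qed
  moreover have "(\<Union>D j q. {x. \<exists>v. v \<in> sphere 0 1 \<and> (v, x) \<in> Z D j q}) \<in> sets borel"
    by (intro sets.countable_UN'' borel_closed closed) auto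
  ultimately have "- uniformly_slow F \<epsilon> C \<in> sets borel"
    by simp
  from borel_comp[OF this] show ?thesis
    by simp
qed

text \<open>The factor \<open>exp (\<epsilon> * real j)\<close> is absorbed in the constant. Only
  membership in the slow space travels along the orbit; a uniform constant is recovered at those
  later points that lie in \<open>uniformly_slow\<close>.\<close>

lemma slow_space_Dit:
  assumes "is_lift F" "C1_map F" "y \<in> Tor" "v \<in> slow_space F \<epsilon> y"
  shows "Dit F j y v \<in> slow_space F \<epsilon> ((tmap F ^^ j) y)"
proof -
  obtain D where D: "\<And>k. norm (Dit F k y v) \<le> D * exp (\<epsilon> * real k)"
    using assms(4) unfolding slow_space_def by blast
  have "norm (Dit F k ((tmap F ^^ j) y) (Dit F j y v)) \<le> (D * exp (\<epsilon> * real j)) * exp (\<epsilon> * real k)" for k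
    using D[of "k + j"] unfolding Dit_add[OF assms(1-3)] by (simp add: exp_add[symmetric] algebra_simps)
  then show ?thesis
    unfolding slow_space_def by blast
qed

text \<open>Split \<open>v\<close> into stable and unstable parts. The stable part contracts from
  time 0 to \<open>j\<close>; the unstable part at time \<open>j\<close> is a pullback from time
  \<open>k + j\<close>. The constant \<open>a\<close> compares each part with the full vector, at
  time 0 and at time \<open>k + j\<close> respectively.\<close>

lemma anosov_orbit_estimate:
  fixes F G :: "real^'n \<Rightarrow> real^'n"
  assumes diffeo: "torus_diffeo F G" and anosov: "anosov F G c lam a"
    and y: "y \<in> Tor" and "0 < j" "0 < k"
  shows "norm (Dit F j y v) \<le> a * c * (lam ^ j * norm v + lam ^ k * norm (Dit F (k + j) y v))"
proof -
  have F: "is_lift F" "C1_map F"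
    using diffeo by (auto simp: torus_diffeo_def)
  note lin = bounded_linear.linear[OF bounded_linear_Dit[OF F(2)]]
  have pos: "0 < c" "0 < lam"
    using anosov by (auto simp: anosov_def)
  obtain Es Eu :: "real^'n \<Rightarrow> (real^'n) set" where split: "\<forall>y\<in>Tor.
       subspace (Es y) \<and> subspace (Eu y) \<and>
       {u + v | u v. u \<in> Es y \<and> v \<in> Eu y} = UNIV \<and> Es y \<inter> Eu y = {0} \<and>
       frechet_derivative F (at y) ` Es y = Es (tmap F y) \<and>
       frechet_derivative F (at y) ` Eu y = Eu (tmap F y) \<and>
       (\<forall>k>0. \<forall>\<eta>\<in>Es y. norm (Dit F k y \<eta>) \<le> c * lam ^ k * norm \<eta>) \<and>
       (\<forall>k>0. \<forall>\<eta>\<in>Eu y. norm (Dit G k y \<eta>) \<le> c * lam ^ k * norm \<eta>) \<and>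
       (\<forall>\<eta>s\<in>Es y. \<forall>\<eta>u\<in>Eu y. norm \<eta>s \<le> a * norm (\<eta>s + \<eta>u) \<and> norm \<eta>u \<le> a * norm (\<eta>s + \<eta>u))"
    using anosov unfolding anosov_def by (elim conjE exE) (rule that)
  have inv_s: "frechet_derivative F (at y) ` Es y = Es (tmap F y)" if "y \<in> Tor" for y
    using bspec[OF split that] by (elim conjE)
  have inv_u: "frechet_derivative F (at y) ` Eu y = Eu (tmap F y)" if "y \<in> Tor" for y
    using bspec[OF split that] by (elim conjE)
  have contr_u: "\<forall>k>0. \<forall>\<eta>\<in>Eu y. norm (Dit G k y \<eta>) \<le> c * lam ^ k * norm \<eta>" if "y \<in> Tor" for y
    using bspec[OF split that] by (elim conjE)
  have contr_s: "\<forall>k>0. \<forall>\<eta>\<in>Es y. norm (Dit F k y \<eta>) \<le> c * lam ^ k * norm \<eta>" if "y \<in> Tor" for y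
    using bspec[OF split that] by (elim conjE)
  have angle: "\<forall>\<eta>s\<in>Es y. \<forall>\<eta>u\<in>Eu y. norm \<eta>s \<le> a * norm (\<eta>s + \<eta>u) \<and> norm \<eta>u \<le> a * norm (\<eta>s + \<eta>u)"
    if "y \<in> Tor" for y
    using bspec[OF split that] by (elim conjE)
  have sum: "{u + v | u v. u \<in> Es y \<and> v \<in> Eu y} = UNIV"
    using bspec[OF split y] by (elim conjE)
  have Dit_s: "Dit F k y p \<in> Es ((tmap F ^^ k) y)" if "y \<in> Tor" "p \<in> Es y" for k y p
  proof (induction k)
    case (Suc k)
    then have "frechet_derivative F (at ((tmap F ^^ k) y)) (Dit F k y p) \<in> Es (tmap F ((tmap F ^^ k) y))"
      using inv_s[OF tmap_funpow_Tor[OF that(1), of k F]] by blast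
    then show ?case
      using Dit_add[OF F that(1), of "Suc 0" k] by (simp add: Dit_1)
  qed (simp add: Dit_0 that)
  have Dit_u: "Dit F k y p \<in> Eu ((tmap F ^^ k) y)" if "y \<in> Tor" "p \<in> Eu y" for k y p
  proof (induction k)
    case (Suc k)
    then have "frechet_derivative F (at ((tmap F ^^ k) y)) (Dit F k y p) \<in> Eu (tmap F ((tmap F ^^ k) y))"
      using inv_u[OF tmap_funpow_Tor[OF that(1), of k F]] by blast
    then show ?case
      using Dit_add[OF F that(1), of "Suc 0" k] by (simp add: Dit_1)
  qed (simp add: Dit_0 that)
  obtain p q where v: "v = p + q" and p: "p \<in> Es y" and q: "q \<in> Eu y"
    using sum by blast
  let ?z = "(tmap F ^^ j) y"
  have z: "?z \<in> Tor"
    using y by (rule tmap_funpow_Tor)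
  have "norm (Dit F j y p) \<le> c * lam ^ j * norm p"
    using contr_s[OF y] \<open>0 < j\<close> p by blast
  also have "\<dots> \<le> c * lam ^ j * (a * norm v)"
    unfolding v using angle[OF y] p q pos by (intro mult_left_mono) auto
  finally have s: "norm (Dit F j y p) \<le> a * c * (lam ^ j * norm v)"
    by (simp add: mult_ac)
  have "norm (Dit F j y q) = norm (Dit G k ((tmap F ^^ k) ?z) (Dit F k ?z (Dit F j y q)))"
    by (simp add: Dit_inverse[OF diffeo z])
  also have "\<dots> \<le> c * lam ^ k * norm (Dit F k ?z (Dit F j y q))"
    using contr_u[OF tmap_funpow_Tor[OF z]] Dit_u[OF z Dit_u[OF y q]] \<open>0 < k\<close> by blast
  also have "\<dots> \<le> c * lam ^ k * (a * norm (Dit F k ?z (Dit F j y p) + Dit F k ?z (Dit F j y q)))"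
    using bspec[OF bspec[OF angle[OF tmap_funpow_Tor[OF z]] Dit_s[OF z Dit_s[OF y p]]]
      Dit_u[OF z Dit_u[OF y q]], of k] pos
    by (intro mult_left_mono) auto
  also have "Dit F k ?z (Dit F j y p) + Dit F k ?z (Dit F j y q) = Dit F (k + j) y v"
    unfolding v linear_add[OF lin] Dit_add[OF F y, of k j] by simp
  finally have u: "norm (Dit F j y q) \<le> a * c * (lam ^ k * norm (Dit F (k + j) y v))"
    by (simp add: mult_ac)
  have "norm (Dit F j y v) \<le> norm (Dit F j y p) + norm (Dit F j y q)"
    unfolding v linear_add[OF lin] by (rule norm_triangle_ineq)
  with s u show ?thesis
    by (simp add: distrib_left)
qed

text \<open>The orbit estimate is used with \<open>j = k = N\<close>. Per unit of
  \<open>real N\<close> the exponents are \<open>- \<kappa>\<close> from the splitting,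
  \<open>\<kappa> / 4\<close> from growth at rate \<open>\<kappa> / 8\<close> over
  \<open>N + N\<close> steps, and \<open>\<kappa> / 4\<close> for the constants, in total
  \<open>- (\<kappa> / 2)\<close>.\<close>

lemma slow_vector_contracts:
  fixes F F' G' :: "real^'n \<Rightarrow> real^'n"
  assumes F: "is_lift F" "C1_map F"
    and diffeo: "torus_diffeo F' G'" and anosov: "anosov F' G' c lam a" and lam: "lam \<le> exp (- \<kappa>)"
    and A: "torus_open A" and agree: "\<And>y. y \<in> A \<Longrightarrow> tmap F' y = tmap F y"
    and y: "y \<in> Tor" and orb: "\<And>i. i < N + N \<Longrightarrow> (tmap F ^^ i) y \<in> A"
    and slow: "y \<in> uniformly_slow F (\<kappa> / 8) C" "v \<in> slow_space F (\<kappa> / 8) y"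
    and C: "1 \<le> C" and \<kappa>: "0 \<le> \<kappa>" and N: "0 < N" "2 * C * (a * c) \<le> exp (\<kappa> / 4 * real N)"
  shows "norm (Dit F N y v) \<le> exp (- (\<kappa> / 2) * real N) * norm v"
proof -
  have F': "is_lift F'" "C1_map F'"
    using diffeo by (auto simp: torus_diffeo_def)
  have pos: "0 < a * c" "0 < lam"
    using anosov by (auto simp: anosov_def)
  have pow: "lam ^ N \<le> exp (- \<kappa> * real N)"
    using power_mono[OF lam, of N] pos by (simp add: exp_of_nat_mult[symmetric] mult.commute)
  have long: "norm (Dit F (N + N) y v) \<le> C * exp (\<kappa> / 4 * real N) * norm v"
  proof -
    have "norm (Dit F (N + N) y v) \<le> C * exp (\<kappa> / 8 * real (N + N)) * norm v"
      using slow unfolding uniformly_slow_def by blast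
    then show ?thesis
      by (simp add: algebra_simps)
  qed
  have "norm (Dit F' N y v) \<le> a * c * (lam ^ N * norm v + lam ^ N * norm (Dit F' (N + N) y v))"
    using diffeo anosov y N(1) N(1) by (rule anosov_orbit_estimate)
  then have "norm (Dit F N y v) \<le> a * c * (lam ^ N * norm v + lam ^ N * norm (Dit F (N + N) y v))"
    using Dit_agree(2)[OF F F' A agree y, of N v] Dit_agree(2)[OF F F' A agree y, of "N + N" v] orb by simp
  also have "\<dots> = a * c * (lam ^ N * (norm v + norm (Dit F (N + N) y v)))"
    by (simp add: distrib_left)
  also have "\<dots> \<le> a * c * (exp (- \<kappa> * real N) * (2 * C * exp (\<kappa> / 4 * real N) * norm v))"
  proof (intro mult_left_mono mult_mono)
    \<comment> \<open>Since \<open>1 \<le> C\<close>, the bound for the later vector also covers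
      \<open>norm v\<close>, which gives the factor 2.\<close>
    have "1 * 1 * norm v \<le> C * exp (\<kappa> / 4 * real N) * norm v"
      using C \<kappa> by (intro mult_right_mono mult_mono) auto
    with long show "norm v + norm (Dit F (N + N) y v) \<le> 2 * C * exp (\<kappa> / 4 * real N) * norm v"
      by simp
  qed (use pow pos in auto)
  also have "\<dots> = 2 * C * (a * c) * (exp (- \<kappa> * real N) * exp (\<kappa> / 4 * real N) * norm v)"
    by (simp add: mult_ac)
  also have "\<dots> \<le> exp (\<kappa> / 4 * real N) * (exp (- \<kappa> * real N) * exp (\<kappa> / 4 * real N) * norm v)"
    using N(2) by (rule mult_right_mono) simp
  also have "\<dots> = exp (\<kappa> / 4 * real N + (- \<kappa> * real N + \<kappa> / 4 * real N)) * norm v"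
    unfolding exp_add by (simp add: mult_ac)
  also have "\<kappa> / 4 * real N + (- \<kappa> * real N + \<kappa> / 4 * real N) = - (\<kappa> / 2) * real N"
    by (simp add: algebra_simps)
  finally show ?thesis .
qed

text \<open>The logarithms \<open>u k\<close> fit \<open>greedy_decay\<close> with visits to
  \<open>E\<close> as bad times: slow vectors stay slow, so the contraction is available at every
  time outside \<open>E\<close>. The bound \<open>t\<close> on the visit frequency then gives the
  rate.\<close>

lemma limsup_growth_slow_vector_le:
  fixes F G :: "real^'n \<Rightarrow> real^'n"
  assumes diffeo: "torus_diffeo F G" and y: "y \<in> Tor" and v: "v \<noteq> 0" "v \<in> slow_space F \<epsilon> y"
    and bnd: "\<And>z. z \<in> Tor \<Longrightarrow> onorm (frechet_derivative F (at z)) \<le> exp \<beta>" and nonneg: "0 \<le> \<beta>" "0 \<le> \<kappa>"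
    and N: "0 < N"
    and contr: "\<And>z w. z \<in> Tor \<Longrightarrow> z \<notin> E \<Longrightarrow> w \<in> slow_space F \<epsilon> z \<Longrightarrow>
      norm (Dit F N z w) \<le> exp (- \<kappa> * real N) * norm w"
    and visits: "\<And>n. (\<Sum>i<n. indicator E ((tmap F ^^ i) y)) \<le> K + t * real n"
  shows "limsup (\<lambda>k. ereal (ln (norm (Dit F k y v)) / real k)) \<le> ereal ((\<beta> + \<kappa>) * t - \<kappa>)"
proof -
  have F: "is_lift F" "C1_map F"
    using diffeo by (auto simp: torus_diffeo_def)
  define u where "u k = ln (norm (Dit F k y v))" for k
  \<comment> \<open>Invertibility keeps the vector nonzero, so inequalities between norms pass to
    logarithms.\<close>
  have pos: "0 < norm (Dit F k y v)" for k
  proof -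
    have "Dit F k y v \<noteq> 0"
    proof
      assume "Dit F k y v = 0"
      then have "Dit G k ((tmap F ^^ k) y) 0 = v"
        using Dit_inverse[OF diffeo y, of k v] by simp
      moreover have "Dit G k ((tmap F ^^ k) y) 0 = 0"
        using diffeo by (intro linear_0 bounded_linear.linear[OF bounded_linear_Dit]) (simp add: torus_diffeo_def)
      ultimately show False
        using v(1) by simp
    qed
    then show ?thesis by simp
  qed
  have step: "u (Suc k) \<le> u k + \<beta>" for k
  proof -
    let ?z = "(tmap F ^^ k) y"
    have "norm (Dit F (Suc k) y v) = norm (Dit F (Suc 0) ?z (Dit F k y v))"
      using Dit_add[OF F y, of "Suc 0" k v] by simp
    also have "\<dots> \<le> onorm (Dit F (Suc 0) ?z) * norm (Dit F k y v)"
      by (rule onorm[OF bounded_linear_Dit[OF F(2)]])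
    also have "\<dots> \<le> exp \<beta> * norm (Dit F k y v)"
      using bnd[OF tmap_funpow_Tor[OF y]] by (intro mult_right_mono) (auto simp: Dit_1)
    finally have "u (Suc k) \<le> ln (exp \<beta> * norm (Dit F k y v))"
      using pos[of "Suc k"] pos[of k] unfolding u_def by (subst ln_le_cancel_iff) auto
    also have "\<dots> = u k + \<beta>"
      using pos[of k] unfolding u_def by (subst ln_mult) auto
    finally show ?thesis .
  qed
  have jump: "u (k + N) \<le> u k - \<kappa> * real N" if "\<not> (tmap F ^^ k) y \<in> E" for k
  proof -
    let ?z = "(tmap F ^^ k) y"
    have "norm (Dit F (k + N) y v) = norm (Dit F N ?z (Dit F k y v))"
      using Dit_add[OF F y, of N k v] by (simp add: add.commute)
    also have "\<dots> \<le> exp (- \<kappa> * real N) * norm (Dit F k y v)"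
      using that by (intro contr tmap_funpow_Tor y slow_space_Dit F v)
    finally have "u (k + N) \<le> ln (exp (- \<kappa> * real N) * norm (Dit F k y v))"
      using pos[of "k + N"] pos[of k] unfolding u_def by (subst ln_le_cancel_iff) auto
    also have "\<dots> = u k - \<kappa> * real N"
      using pos[of k] unfolding u_def by (subst ln_mult) auto
    finally show ?thesis .
  qed
  \<comment> \<open>All terms independent of \<open>n\<close>; they contribute nothing to the
    limsup.\<close>
  define R where "R = u 0 + (\<beta> + \<kappa>) * K + (\<beta> + \<kappa>) * real N"
  have "u n \<le> ((\<beta> + \<kappa>) * t - \<kappa>) * real n + R" for n
  proof -
    have "(\<Sum>i=0..<n. of_bool ((tmap F ^^ i) y \<in> E)) = (\<Sum>i<n. indicator E ((tmap F ^^ i) y) :: real)"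
      by (intro sum.cong) (auto simp: indicator_def)
    then have "(\<beta> + \<kappa>) * (\<Sum>i=0..<n. of_bool ((tmap F ^^ i) y \<in> E)) \<le> (\<beta> + \<kappa>) * (K + t * real n)"
      using visits[of n] nonneg by (intro mult_left_mono) auto
    with greedy_decay[where u = u and k = 0 and n = n and bad = "\<lambda>i. (tmap F ^^ i) y \<in> E",
        OF N nonneg(2,1) step jump]
    show ?thesis
      by (simp add: R_def algebra_simps)
  qed
  then have "u n / real n \<le> (\<beta> + \<kappa>) * t - \<kappa> + R / real n" if "0 < n" for n
    using that by (simp add: field_simps)
  then have "limsup (\<lambda>n. ereal (u n / real n)) \<le> limsup (\<lambda>n. ereal ((\<beta> + \<kappa>) * t - \<kappa> + R / real n))"
    by (intro Limsup_mono eventually_mono[OF eventually_gt_at_top[of 0]]) simp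
  also have "(\<lambda>n. (\<beta> + \<kappa>) * t - \<kappa> + R / real n) \<longlonglongrightarrow> (\<beta> + \<kappa>) * t - \<kappa> + 0"
    by (intro tendsto_intros lim_const_over_n)
  then have "limsup (\<lambda>n. ereal ((\<beta> + \<kappa>) * t - \<kappa> + R / real n)) = ereal ((\<beta> + \<kappa>) * t - \<kappa>)"
    by (intro lim_imp_Limsup) simp_all
  finally show ?thesis
    unfolding u_def .
qed

text \<open>A zero limsup gives the exponential bound from some time \<open>m\<close> on; the
  finitely many earlier norms go into the constant.\<close>

lemma slow_space_if_limsup_zero:
  assumes "limsup (\<lambda>k. ereal (ln (norm (Dit F k y v)) / real k)) = 0" and "0 < \<epsilon>"
  shows "v \<in> slow_space F \<epsilon> y"
proof -
  have "\<forall>\<^sub>F k in sequentially. ereal (ln (norm (Dit F k y v)) / real k) < ereal \<epsilon>"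
    using assms by (intro Limsup_lessD) (simp add: zero_ereal_def[symmetric])
  then obtain m where m: "\<And>k. m \<le> k \<Longrightarrow> ln (norm (Dit F k y v)) / real k < \<epsilon>"
    by (auto simp: eventually_sequentially)
  \<comment> \<open>The summand 1 serves the times beyond \<open>m\<close>, the sum those up to
    \<open>m\<close>.\<close>
  define D where "D = 1 + (\<Sum>k\<le>m. norm (Dit F k y v))"
  have D: "1 \<le> D"
    unfolding D_def by (simp add: sum_nonneg)
  have "norm (Dit F k y v) \<le> D * exp (\<epsilon> * real k)" for k
  proof (cases "k \<le> m")
    case True
    have "norm (Dit F k y v) \<le> (\<Sum>k\<le>m. norm (Dit F k y v))"
      using True by (intro member_le_sum) auto
    then have "norm (Dit F k y v) \<le> D * 1"
      by (simp add: D_def)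
    also have "\<dots> \<le> D * exp (\<epsilon> * real k)"
      using D assms(2) by (intro mult_left_mono) auto
    finally show ?thesis .
  next
    case False
    show ?thesis
    proof (cases "Dit F k y v = 0")
      case False
      have "ln (norm (Dit F k y v)) \<le> \<epsilon> * real k"
        using m[of k] \<open>\<not> k \<le> m\<close> by (simp add: field_simps)
      then have "norm (Dit F k y v) \<le> 1 * exp (\<epsilon> * real k)"
        using False by (metis exp_le_cancel_iff exp_ln mult_1 zero_less_norm_iff)
      also have "\<dots> \<le> D * exp (\<epsilon> * real k)"
        using D by (intro mult_right_mono) auto
      finally show ?thesis .
    qed (use D in simp)
  qed
  then show ?thesis
    unfolding slow_space_def by blast
qed

section \<open>Approximation by Anosov diffeomorphisms\<close>

theorem theorem4p1:
  fixes F G :: "real^'n \<Rightarrow> real^'n"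
    and Fm Gm :: "nat \<Rightarrow> real^'n \<Rightarrow> real^'n"
    and \<mu> :: "(real^'n) measure"
    and c lam a :: "nat \<Rightarrow> real"
    and A :: "nat \<Rightarrow> (real^'n) set"
    and b lam0 :: real
  assumes diffeo: "torus_diffeo F G"
    and prob: "torus_prob \<mu>"
    and erg: "ergodic (tmap F) \<mu>"
    and anos: "\<And>m. m \<ge> 1 \<Longrightarrow> torus_diffeo (Fm m) (Gm m) \<and> anosov (Fm m) (Gm m) (c m) (lam m) (a m)"
    and opn: "\<And>m. m \<ge> 1 \<Longrightarrow> torus_open (A m)"
    and mono: "\<And>m. m \<ge> 1 \<Longrightarrow> A m \<subseteq> A (Suc m)"
    and inv: "tmap F -` (\<Union>m\<in>{1..}. A m) \<inter> Tor = (\<Union>m\<in>{1..}. A m)"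
    and agree: "\<And>m y. m \<ge> 1 \<Longrightarrow> y \<in> A m \<Longrightarrow> tmap (Fm m) y = tmap F y"
    and bpos: "b > 0"
    and bnd: "\<And>m y. m \<ge> 1 \<Longrightarrow> y \<in> Tor \<Longrightarrow> onorm (frechet_derivative (Fm m) (at y)) \<le> b"
    and bndf: "\<And>y. y \<in> Tor \<Longrightarrow> onorm (frechet_derivative F (at y)) \<le> b"
    and lam1: "lam0 < 1"
    and laml: "\<And>m. m \<ge> 1 \<Longrightarrow> lam m \<le> lam0"
    and full: "measure \<mu> (\<Union>m\<in>{1..}. A m) = 1"
    and lim: "(\<lambda>m. measure \<mu> (Tor - A m) * ln (a m * c m)) \<longlonglongrightarrow> 0"
  shows "hyperbolic_measure F \<mu>"
proof -
  note F = diffeo[unfolded torus_diffeo_def]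
  have lift: "is_lift F" and C1: "C1_map F"
    using F by auto
  interpret prob_space \<mu>
    using prob by (simp add: torus_prob_def)
  have sets: "sets \<mu> = sets (restrict_space borel Tor)"
    using prob by (simp add: torus_prob_def)
  have space: "space \<mu> = Tor"
    using sets_eq_imp_space_eq[OF sets] by (simp add: space_restrict_space)
  have Tor_Int_sets: "Tor \<inter> S \<in> sets \<mu>" if "S \<in> sets borel" for S
    using that unfolding sets sets_restrict_space by blast
  have A_sets: "A m \<in> sets \<mu>" if "m \<ge> 1" for m
  proof -
    have "A m \<subseteq> Tor" "open (torus_proj -` A m)"
      using opn[OF that] by (auto simp: torus_open_def)
    moreover from this(1) have "A m = Tor \<inter> torus_proj -` A m"
      by (auto simp: torus_proj_Tor)
    ultimately show ?thesis
      using Tor_Int_sets[of "torus_proj -` A m"] by simp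
  qed

  \<comment> \<open>Rates and constants\<close>
  define \<kappa> where "\<kappa> = - ln lam0"
  \<comment> \<open>Taking \<open>max b 1\<close> makes \<open>\<beta>\<close> nonnegative, as the
    greedy walk requires.\<close>
  define \<beta> where "\<beta> = ln (max b 1)"
  \<comment> \<open>Chosen so that an exceptional set visited with frequency \<open>t\<close> costs
    at most \<open>\<kappa> / 4\<close>, half of the contraction rate \<open>\<kappa> / 2\<close>
    off that set.\<close>
  define t where "t = \<kappa> / 4 / (\<beta> + \<kappa>)"
  have lam0_pos: "0 < lam0"
    using anos[of 1] laml[of 1] by (auto simp: anosov_def)
  then have \<kappa>: "0 < \<kappa>" and exp_\<kappa>: "exp (- \<kappa>) = lam0"
    using lam1 by (simp_all add: \<kappa>_def)
  have \<beta>: "0 \<le> \<beta>" and exp_\<beta>: "exp \<beta> = max b 1"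
    by (simp_all add: \<beta>_def)
  have "0 < \<beta> + \<kappa>"
    using \<kappa> \<beta> by simp
  then have t: "0 < t" and t_eq: "(\<beta> + \<kappa>) * t = \<kappa> / 4"
    using \<kappa> by (simp_all add: t_def nonzero_eq_divide_eq del: divide_divide_eq_left)

  \<comment> \<open>\<open>C\<close> is fixed before the index \<open>m\<close>, since the time
    \<open>N m\<close> depends on it. Half of the measure budget \<open>t\<close> goes to points
    that are not uniformly slow.\<close>
  obtain C :: real where C: "1 \<le> C" and C_meas: "measure \<mu> (Tor - uniformly_slow F (\<kappa> / 8) C) < t / 2"
  proof -
    let ?U = "\<lambda>n::nat. Tor \<inter> uniformly_slow F (\<kappa> / 8) (real n)"
    have "incseq ?U"
      by (intro monoI Int_mono uniformly_slow_mono order_refl) simp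
    then have "(\<lambda>n. measure \<mu> (?U n)) \<longlonglongrightarrow> measure \<mu> (\<Union>n. ?U n)"
      using uniformly_slow_borel[OF C1] by (intro finite_Lim_measure_incseq) (auto intro!: Tor_Int_sets)
    also have "(\<Union>n. ?U n) = Tor"
    proof -
      have "\<exists>n::nat. x \<in> uniformly_slow F (\<kappa> / 8) (real n)" for x
      proof -
        obtain D where "x \<in> uniformly_slow F (\<kappa> / 8) D"
          using ex_uniformly_slow[OF C1] by blast
        then show ?thesis
          using uniformly_slow_mono[OF real_nat_ceiling_ge] by blast
      qed
      then show ?thesis by blast
    qed
    finally have "(\<lambda>n. measure \<mu> (?U n)) \<longlonglongrightarrow> 1"
      using prob_space space by simp
    then have "\<forall>\<^sub>F n in sequentially. 1 - t / 2 < measure \<mu> (?U n)"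
      using t by (intro order_tendstoD) auto
    then have "\<forall>\<^sub>F n in sequentially. 1 - t / 2 < measure \<mu> (?U n) \<and> 1 \<le> n"
      by (intro eventually_conj eventually_ge_at_top)
    then obtain n where n: "1 - t / 2 < measure \<mu> (?U n)" "1 \<le> n"
      by (auto simp: eventually_sequentially)
    have "Tor - uniformly_slow F (\<kappa> / 8) (real n) = space \<mu> - ?U n"
      by (auto simp: space)
    then have "measure \<mu> (Tor - uniformly_slow F (\<kappa> / 8) (real n)) = 1 - measure \<mu> (?U n)"
      using prob_compl[OF Tor_Int_sets[OF uniformly_slow_borel[OF C1]]] by simp
    then show thesis
      using n that[of "real n"] by simp
  qed

  \<comment> \<open>Choice of the approximating Anosov diffeomorphism\<close>
  define \<delta> where "\<delta> m = measure \<mu> (Tor - A m)" for m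
  \<comment> \<open>The time that hyperbolicity of \<open>f\<^sub>m\<close> needs to absorb its constants; the hypothesis on
    \<open>\<mu>(M \<setminus> A\<^sub>m) log (a\<^sub>m c\<^sub>m)\<close> makes it short compared with \<open>1 / \<delta> m\<close>.\<close>
  define N where "N m = Suc (nat \<lceil>4 / \<kappa> * ln (2 * C * (a m * c m))\<rceil>)" for m
  have ac: "0 < a m * c m" if "m \<ge> 1" for m
    using anos[OF that] by (simp add: anosov_def)
  have N_ge: "2 * C * (a m * c m) \<le> exp (\<kappa> / 4 * real (N m))" if "m \<ge> 1" for m
  proof -
    have "4 / \<kappa> * ln (2 * C * (a m * c m)) \<le> real (N m)"
      unfolding N_def using real_nat_ceiling_ge[of "4 / \<kappa> * ln (2 * C * (a m * c m))"]
      by (simp only: of_nat_Suc)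
    then have "ln (2 * C * (a m * c m)) \<le> \<kappa> / 4 * real (N m)"
      using \<kappa> by (simp add: field_simps)
    then have "exp (ln (2 * C * (a m * c m))) \<le> exp (\<kappa> / 4 * real (N m))"
      by simp
    then show ?thesis
      using ac[OF that] C by simp
  qed
  \<comment> \<open>The absolute value allows for a negative logarithm; the constant 2 covers the
    successor and the rounding.\<close>
  have N_le: "real (N m) \<le> 2 + 4 / \<kappa> * ln (2 * C) + 4 / \<kappa> * \<bar>ln (a m * c m)\<bar>" if "m \<ge> 1" for m
  proof -
    have "ln (2 * C * (a m * c m)) = ln (2 * C) + ln (a m * c m)"
      using ac[OF that] C by (intro ln_mult_pos) auto
    then have "4 / \<kappa> * ln (2 * C * (a m * c m)) \<le> 4 / \<kappa> * (ln (2 * C) + \<bar>ln (a m * c m)\<bar>)"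
      using \<kappa> by (intro mult_left_mono) auto
    moreover have "0 \<le> 4 / \<kappa> * (ln (2 * C) + \<bar>ln (a m * c m)\<bar>)"
      using \<kappa> C by simp
    moreover have "real (nat \<lceil>r\<rceil>) \<le> s + 1" if "r \<le> s" "0 \<le> s" for r s :: real
      using that by linarith
    ultimately show ?thesis
      unfolding N_def by (fastforce simp: distrib_left)
  qed
  \<comment> \<open>The limit hypothesis controls the logarithmic part of \<open>N m\<close>; the
    constant part needs \<open>\<delta>\<close> to tend to 0, which follows from the full measure of
    the union.\<close>
  have \<delta>_lim: "\<delta> \<longlonglongrightarrow> 0"
  proof -
    have "(\<lambda>m. measure \<mu> (A (Suc m))) \<longlonglongrightarrow> measure \<mu> (\<Union>m. A (Suc m))"
      using mono A_sets by (intro finite_Lim_measure_incseq) (auto intro!: incseq_SucI)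
    moreover have "(\<Union>m. A (Suc m)) = (\<Union>m\<in>{1..}. A m)"
      by (force dest: Suc_le_D)
    ultimately have "(\<lambda>m. 1 - measure \<mu> (A (Suc m))) \<longlonglongrightarrow> 1 - 1"
      using full by (intro tendsto_diff tendsto_const) simp
    moreover have "\<delta> (Suc m) = 1 - measure \<mu> (A (Suc m))" for m
      using prob_compl[OF A_sets[of "Suc m"]] by (simp add: \<delta>_def space)
    ultimately show ?thesis
      by (subst filterlim_sequentially_Suc[symmetric]) simp
  qed
  have "(\<lambda>m. \<delta> m * (2 + 4 / \<kappa> * ln (2 * C)) + 4 / \<kappa> * \<bar>\<delta> m * ln (a m * c m)\<bar>)
      \<longlonglongrightarrow> 0 * (2 + 4 / \<kappa> * ln (2 * C)) + 4 / \<kappa> * \<bar>0\<bar>"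
    using lim unfolding \<delta>_def[symmetric] by (intro tendsto_intros \<delta>_lim)
  \<comment> \<open>A quarter of \<open>t\<close> is the target because the exceptional set involves
    \<open>N m + N m\<close> preimages of the complement of \<open>A m\<close>.\<close>
  then have "\<forall>\<^sub>F m in sequentially. \<delta> m * (2 + 4 / \<kappa> * ln (2 * C)) + 4 / \<kappa> * \<bar>\<delta> m * ln (a m * c m)\<bar> < t / 4"
    using t by (intro order_tendstoD) auto
  then have "\<forall>\<^sub>F m in sequentially.
      \<delta> m * (2 + 4 / \<kappa> * ln (2 * C)) + 4 / \<kappa> * \<bar>\<delta> m * ln (a m * c m)\<bar> < t / 4 \<and> 1 \<le> m"
    by (intro eventually_conj eventually_ge_at_top)
  then obtain m where m: "1 \<le> m"
    and m_less: "\<delta> m * (2 + 4 / \<kappa> * ln (2 * C)) + 4 / \<kappa> * \<bar>\<delta> m * ln (a m * c m)\<bar> < t / 4"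
    by (auto simp: eventually_sequentially)
  have "\<delta> m * real (N m) \<le> \<delta> m * (2 + 4 / \<kappa> * ln (2 * C) + 4 / \<kappa> * \<bar>ln (a m * c m)\<bar>)"
    by (intro mult_left_mono N_le m) (simp add: \<delta>_def)
  also have "\<dots> = \<delta> m * (2 + 4 / \<kappa> * ln (2 * C)) + 4 / \<kappa> * \<bar>\<delta> m * ln (a m * c m)\<bar>"
    by (simp add: \<delta>_def abs_mult algebra_simps)
  finally have N_less: "\<delta> m * real (N m) < t / 4"
    using m_less by linarith

  \<comment> \<open>The exceptional set and contraction off it\<close>
  let ?T = "tmap F"
  have T: "?T \<in> measurable \<mu> \<mu>"
    and pres: "\<And>B. B \<in> sets \<mu> \<Longrightarrow> measure \<mu> (?T -` B \<inter> space \<mu>) = measure \<mu> B"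
    using erg by (auto simp: ergodic_def invariant_measure_def)
  have pres_pow: "measure \<mu> ((?T ^^ i) -` B \<inter> Tor) = measure \<mu> B" if B: "B \<in> sets \<mu>" for i B
  proof (induction i)
    case 0
    have "B \<subseteq> Tor"
      using sets.sets_into_space[OF B] space by simp
    then show ?case
      by (simp add: Int_absorb2)
  next
    case (Suc i)
    have "?T -` ((?T ^^ i) -` B \<inter> Tor) \<inter> Tor = (?T ^^ Suc i) -` B \<inter> Tor"
      using tmap_funpow_Tor[of _ 1 F] by (auto simp: funpow_swap1)
    then show ?case
      using Suc pres[OF measurable_sets[OF measurable_funpow[OF T] B, of i]] by (simp add: space del: funpow.simps)
  qed

  \<comment> \<open>Off \<open>E\<close>, every slow vector is contracted at rate \<open>\<kappa> / 2\<close> over \<open>N m\<close> steps.\<close>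
  define E where "E = (Tor - uniformly_slow F (\<kappa> / 8) C) \<union> (\<Union>i<N m + N m. (?T ^^ i) -` (Tor - A m) \<inter> Tor)"
  have slow_sets: "Tor - uniformly_slow F (\<kappa> / 8) C \<in> sets \<mu>"
    using Tor_Int_sets[OF borel_comp[OF uniformly_slow_borel[OF C1]]] by (simp add: Diff_eq)
  have bad_sets: "Tor - A m \<in> sets \<mu>"
    using sets.compl_sets[OF A_sets[OF m]] by (simp add: space)
  have pre_sets: "(?T ^^ i) -` (Tor - A m) \<inter> Tor \<in> sets \<mu>" for i
    using measurable_sets[OF measurable_funpow[OF T] bad_sets] by (simp add: space)
  have E_sets: "E \<in> sets \<mu>"
    unfolding E_def by (intro sets.Un sets.finite_UN slow_sets pre_sets finite_lessThan)
  have "measure \<mu> E \<le> measure \<mu> (Tor - uniformly_slow F (\<kappa> / 8) C)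
      + measure \<mu> (\<Union>i<N m + N m. (?T ^^ i) -` (Tor - A m) \<inter> Tor)"
    unfolding E_def
    by (intro measure_Un_le sets.finite_UN slow_sets pre_sets finite_lessThan)
  \<comment> \<open>By invariance each preimage has measure \<open>\<delta> m\<close>, so the union
    costs less than the other half of the budget.\<close>
  also have "measure \<mu> (\<Union>i<N m + N m. (?T ^^ i) -` (Tor - A m) \<inter> Tor)
      \<le> (\<Sum>i<N m + N m. measure \<mu> ((?T ^^ i) -` (Tor - A m) \<inter> Tor))"
    using pre_sets by (intro finite_measure_subadditive_finite) blast+
  also have "\<dots> = 2 * (\<delta> m * real (N m))"
    by (simp add: pres_pow[OF bad_sets] \<delta>_def)
  finally have E_less: "measure \<mu> E < t"
    using C_meas N_less by linarith

  have contr: "norm (Dit F (N m) z w) \<le> exp (- (\<kappa> / 2) * real (N m)) * norm w"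
    if z: "z \<in> Tor" "z \<notin> E" and w: "w \<in> slow_space F (\<kappa> / 8) z" for z w
  proof (rule slow_vector_contracts)
    show "torus_diffeo (Fm m) (Gm m)" "anosov (Fm m) (Gm m) (c m) (lam m) (a m)"
      using anos[OF m] by auto
    show "(?T ^^ i) z \<in> A m" if "i < N m + N m" for i
      using z that tmap_funpow_Tor[OF z(1)] by (auto simp: E_def)
    show "z \<in> uniformly_slow F (\<kappa> / 8) C"
      using z by (auto simp: E_def)
    show "lam m \<le> exp (- \<kappa>)"
      using laml[OF m] exp_\<kappa> by simp
    show "tmap (Fm m) y = tmap F y" if "y \<in> A m" for y
      using agree[OF m that] .
    show "0 < N m"
      by (simp add: N_def)
  qed (use lift C1 opn[OF m] z w C \<kappa> N_ge[OF m] in auto)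

  \<comment> \<open>Negative exponents of slow vectors\<close>
  have rate: "(\<beta> + \<kappa> / 2) * t - \<kappa> / 2 < 0"
  proof -
    have "(\<beta> + \<kappa> / 2) * t \<le> (\<beta> + \<kappa>) * t"
      using \<kappa> t by (intro mult_right_mono) auto
    then show ?thesis
      using t_eq \<kappa> by linarith
  qed
  \<comment> \<open>\<open>E\<close> does not depend on a vector, so one null set serves all
    \<open>v\<close> at once.\<close>
  have "AE x in \<mu>. \<exists>K. \<forall>n. (\<Sum>i<n. indicator E ((?T ^^ i) x)) \<le> K + t * real n"
    by (rule ergodic_visits_bound[OF prob_space_axioms erg E_sets E_less])
  with AE_space show ?thesis
    unfolding hyperbolic_measure_def
  proof eventually_elim
    case (elim x)
    then obtain K where x: "x \<in> Tor" and K: "\<And>n. (\<Sum>i<n. indicator E ((?T ^^ i) x)) \<le> K + t * real n"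
      using space by auto
    show ?case
    proof (intro allI impI notI)
      fix v :: "real^'n"
      assume v: "v \<noteq> 0" and zero: "limsup (\<lambda>k. ereal (ln (norm (Dit F k x v)) / real k)) = 0"
      have "v \<in> slow_space F (\<kappa> / 8) x"
        using zero \<kappa> by (intro slow_space_if_limsup_zero) auto
      then have "limsup (\<lambda>k. ereal (ln (norm (Dit F k x v)) / real k)) \<le> ereal ((\<beta> + \<kappa> / 2) * t - \<kappa> / 2)"
      proof (rule limsup_growth_slow_vector_le[OF diffeo x v])
        show "onorm (frechet_derivative F (at z)) \<le> exp \<beta>" if "z \<in> Tor" for z
          using bndf[OF that] exp_\<beta> by simp
        show "norm (Dit F (N m) z w) \<le> exp (- (\<kappa> / 2) * real (N m)) * norm w"
          if "z \<in> Tor" "z \<notin> E" "w \<in> slow_space F (\<kappa> / 8) z" for z w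
          using that by (rule contr)
        show "(\<Sum>i<n. indicator E ((?T ^^ i) x)) \<le> K + t * real n" for n
          by (rule K)
      qed (use \<beta> \<kappa> in \<open>auto simp: N_def\<close>)
      with zero rate show False
        by simp
    qed
  qed
qed

end
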